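(* Let $d\ge 3$ be an integer, let $S$ be a finite set of positive real numbers, and let $a_m\in\mathbb{R}$ and $c_m>0$ for each $m\in S$. Let $m_0,\mu\in\mathbb{R}$. On coordinates $(t,z,x^1,\dots,x^{d-1})$ with $z>0$, consider the metric $$ds^2=\frac{1}{z^2}\Big(-F(z)\,dt^2+\frac{dz^2}{F(z)}+\sum_{i=1}^{d-1}(dx^i)^2\Big),$$ the gauge potential $A=\mu(1-z^{d-2})\,dt$, and the scalar fields $\phi_{m,I}=c_m x^I$ for $m\in S$, $1\le I\le d-1$, where $$F(z)=1-m_0z^d+\frac{(d-2)\mu^2}{2(d-1)}z^{2(d-1)}+\sum_{m\in S,\;2m\neq d}\frac{a_m}{2m-d}(c_mz)^{2m}+\sum_{m\in S,\;2m=d}a_m(c_mz)^d\ln z .$$ Then, on every region where $F>0$, these fields solve the Einstein–Maxwell–scalar equations of the action $$\int d^{d+1}x\sqrt{-g}\,\Big(R+d(d-1)-\tfrac14F_{\mu\nu}F^{\mu\nu}-\sum_{m\in S}a_m\sum_{I=1}^{d-1}\big((\partial\phi_{m,I})^2\big)^m\Big),$$ that is, the equations (E), (M), (S) written out in the context.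
   Context: Signature is $(-,+,\dots,+)$; $F_{\mu\nu}=\partial_\mu A_\nu-\partial_\nu A_\mu$ is the field strength (not to be confused with the function $F(z)$) and $F^2=F_{\mu\nu}F^{\mu\nu}$; $(\partial\phi)^2=g^{\mu\nu}\partial_\mu\phi\,\partial_\nu\phi$. Write $X_{m,I}=(\partial\phi_{m,I})^2$, assumed positive. The equations of motion are: (E) $R_{\mu\nu}=-d\,g_{\mu\nu}+\tfrac12\Big(F_{\mu\rho}F_\nu{}^{\rho}-\tfrac{1}{2(d-1)}F^2g_{\mu\nu}\Big)+\bar T_{\mu\nu}$, where $\bar T_{\mu\nu}=T_{\mu\nu}-\tfrac{1}{d-1}T^\rho{}_\rho\, g_{\mu\nu}$ and $$T_{\mu\nu}=\tfrac12\sum_{m\in S}\sum_{I=1}^{d-1}\Big(2\,m\,a_m X_{m,I}^{m-1}\,\partial_\mu\phi_{m,I}\,\partial_\nu\phi_{m,I}-a_mX_{m,I}^m\,g_{\mu\nu}\Big);$$ (M) $\nabla_\mu F^{\mu\nu}=0$; (S) $\nabla^\mu\big(X_{m,I}^{m-1}\nabla_\mu\phi_{m,I}\big)=0$ for all $m\in S$, $1\le I\le d-1$. The sign convention for the Ricci tensor is that anti-de Sitter space ($F\equiv1$ in the metric above) satisfies $R_{\mu\nu}=-d\,g_{\mu\nu}$. *)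

theory Defs
  imports "HOL-Analysis.Analysis"
begin

section \<open>Coordinates\<close>

text \<open>The index type of the coordinates \<open>(t, z, x\<^sup>1, \<dots>, x\<^sup>d\<^sup>-\<^sup>1)\<close>: a type \<open>'n\<close> with
  \<open>d - 1\<close> elements labels the \<open>x\<^sup>i\<close>, so that a point is a vector in \<open>\<real>\<^sup>d\<^sup>+\<^sup>1\<close>.\<close>

datatype 'n coord = Time | Radial | Space 'n

instance coord :: (finite) finite
proof
  have "(UNIV :: 'a coord set) = {Time, Radial} \<union> range Space"
    using coord.exhaust by auto
  then show "finite (UNIV :: 'a coord set)"
    by (metis finite.emptyI finite.insertI finite_UnI finite_imageI finite_class.finite_UNIV)
qed


section \<open>Coordinate calculus on an open set of \<open>\<real>\<^sup>N\<close>\<close>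

text \<open>Tensor fields are given by their components in the coordinates. Superscripts are
  written out by means of the inverse metric.\<close>

definition partial :: "'i::finite \<Rightarrow> (real^'i \<Rightarrow> real) \<Rightarrow> real^'i \<Rightarrow> real" where
  "partial i f x = frechet_derivative f (at x) (axis i 1)"

definition twice_differentiable_on :: "(real^'i::finite \<Rightarrow> real) \<Rightarrow> (real^'i) set \<Rightarrow> bool" where
  "twice_differentiable_on f U \<longleftrightarrow>
     (\<forall>x\<in>U. f differentiable (at x)) \<and> (\<forall>i. \<forall>x\<in>U. partial i f differentiable (at x))"

definition inv_metric :: "(real^'i \<Rightarrow> real^'i^'i) \<Rightarrow> 'i::finite \<Rightarrow> 'i \<Rightarrow> real^'i \<Rightarrow> real" where
  "inv_metric g i j x = matrix_inv (g x) $ i $ j"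

text \<open>\<open>christoffel g r i j\<close> is \<open>\<Gamma>\<^sup>r\<^sub>i\<^sub>j\<close>.\<close>

definition christoffel ::
  "(real^'i \<Rightarrow> real^'i^'i) \<Rightarrow> 'i::finite \<Rightarrow> 'i \<Rightarrow> 'i \<Rightarrow> real^'i \<Rightarrow> real" where
  "christoffel g r i j x =
     1/2 * (\<Sum>s\<in>UNIV. inv_metric g r s x *
       (partial i (\<lambda>y. g y $ s $ j) x + partial j (\<lambda>y. g y $ s $ i) x
        - partial s (\<lambda>y. g y $ i $ j) x))"

text \<open>\<open>riemann g r s i j\<close> is \<open>R\<^sup>r\<^sub>s\<^sub>i\<^sub>j\<close>, with the sign for which spheres have positive and
  anti-de Sitter space has negative Ricci curvature.\<close>

definition riemann ::
  "(real^'i \<Rightarrow> real^'i^'i) \<Rightarrow> 'i::finite \<Rightarrow> 'i \<Rightarrow> 'i \<Rightarrow> 'i \<Rightarrow> real^'i \<Rightarrow> real" where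
  "riemann g r s i j x =
     partial i (christoffel g r j s) x - partial j (christoffel g r i s) x
     + (\<Sum>l\<in>UNIV. christoffel g r i l x * christoffel g l j s x
                  - christoffel g r j l x * christoffel g l i s x)"

definition ricci :: "(real^'i \<Rightarrow> real^'i^'i) \<Rightarrow> 'i::finite \<Rightarrow> 'i \<Rightarrow> real^'i \<Rightarrow> real" where
  "ricci g i j x = (\<Sum>r\<in>UNIV. riemann g r i r j x)"

text \<open>\<open>cov_deriv_covector g w i j\<close> is \<open>\<nabla>\<^sub>i w\<^sub>j\<close>, and \<open>cov_deriv_bivector g B r i j\<close> is
  \<open>\<nabla>\<^sub>r B\<^sup>i\<^sup>j\<close>.\<close>

definition cov_deriv_covector ::
  "(real^'i \<Rightarrow> real^'i^'i) \<Rightarrow> ('i \<Rightarrow> real^'i \<Rightarrow> real) \<Rightarrow> 'i::finite \<Rightarrow> 'i \<Rightarrow> real^'i \<Rightarrow> real" where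
  "cov_deriv_covector g w i j x =
     partial i (w j) x - (\<Sum>l\<in>UNIV. christoffel g l i j x * w l x)"

definition cov_deriv_bivector ::
  "(real^'i \<Rightarrow> real^'i^'i) \<Rightarrow> ('i \<Rightarrow> 'i \<Rightarrow> real^'i \<Rightarrow> real)
     \<Rightarrow> 'i::finite \<Rightarrow> 'i \<Rightarrow> 'i \<Rightarrow> real^'i \<Rightarrow> real" where
  "cov_deriv_bivector g B r i j x =
     partial r (B i j) x
     + (\<Sum>l\<in>UNIV. christoffel g i r l x * B l j x)
     + (\<Sum>l\<in>UNIV. christoffel g j r l x * B i l x)"


section \<open>Electromagnetic field and scalars\<close>

definition field_strength ::
  "(real^'i \<Rightarrow> real^'i) \<Rightarrow> 'i::finite \<Rightarrow> 'i \<Rightarrow> real^'i \<Rightarrow> real" where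
  "field_strength A i j x = partial i (\<lambda>y. A y $ j) x - partial j (\<lambda>y. A y $ i) x"

definition field_strength_up ::
  "(real^'i \<Rightarrow> real^'i^'i) \<Rightarrow> (real^'i \<Rightarrow> real^'i) \<Rightarrow> 'i::finite \<Rightarrow> 'i \<Rightarrow> real^'i \<Rightarrow> real" where
  "field_strength_up g A i j x =
     (\<Sum>r\<in>UNIV. \<Sum>s\<in>UNIV. inv_metric g i r x * inv_metric g j s x * field_strength A r s x)"

definition field_strength_sq ::
  "(real^'i::finite \<Rightarrow> real^'i^'i) \<Rightarrow> (real^'i \<Rightarrow> real^'i) \<Rightarrow> real^'i \<Rightarrow> real" where
  "field_strength_sq g A x =
     (\<Sum>i\<in>UNIV. \<Sum>j\<in>UNIV. field_strength A i j x * field_strength_up g A i j x)"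

definition kinetic ::
  "(real^'i::finite \<Rightarrow> real^'i^'i) \<Rightarrow> (real^'i \<Rightarrow> real) \<Rightarrow> real^'i \<Rightarrow> real" where
  "kinetic g \<phi> x =
     (\<Sum>i\<in>UNIV. \<Sum>j\<in>UNIV. inv_metric g i j x * partial i \<phi> x * partial j \<phi> x)"

text \<open>The scalars form a family \<open>\<phi> m I\<close> with \<open>m \<in> S\<close> and \<open>I\<close> ranging over the type \<open>'n\<close>.
  The powers of the kinetic terms are real powers, meaningful where these are positive.\<close>

definition stress ::
  "real set \<Rightarrow> (real \<Rightarrow> real) \<Rightarrow> (real^'i \<Rightarrow> real^'i^'i)
     \<Rightarrow> (real \<Rightarrow> 'n::finite \<Rightarrow> real^'i \<Rightarrow> real) \<Rightarrow> 'i::finite \<Rightarrow> 'i \<Rightarrow> real^'i \<Rightarrow> real" where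
  "stress S a g \<phi> i j x =
     1/2 * (\<Sum>m\<in>S. \<Sum>I\<in>UNIV.
       2 * m * a m * kinetic g (\<phi> m I) x powr (m - 1)
         * partial i (\<phi> m I) x * partial j (\<phi> m I) x
       - a m * kinetic g (\<phi> m I) x powr m * g x $ i $ j)"

definition reduced_stress ::
  "nat \<Rightarrow> real set \<Rightarrow> (real \<Rightarrow> real) \<Rightarrow> (real^'i \<Rightarrow> real^'i^'i)
     \<Rightarrow> (real \<Rightarrow> 'n::finite \<Rightarrow> real^'i \<Rightarrow> real) \<Rightarrow> 'i::finite \<Rightarrow> 'i \<Rightarrow> real^'i \<Rightarrow> real" where
  "reduced_stress d S a g \<phi> i j x =
     stress S a g \<phi> i j x
     - 1 / (real d - 1)
       * (\<Sum>r\<in>UNIV. \<Sum>s\<in>UNIV. inv_metric g r s x * stress S a g \<phi> r s x) * g x $ i $ j"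


section \<open>Einstein--Maxwell--scalar equations\<close>

definition einstein_equation ::
  "nat \<Rightarrow> real set \<Rightarrow> (real \<Rightarrow> real) \<Rightarrow> (real^'i::finite \<Rightarrow> real^'i^'i) \<Rightarrow> (real^'i \<Rightarrow> real^'i)
     \<Rightarrow> (real \<Rightarrow> 'n::finite \<Rightarrow> real^'i \<Rightarrow> real) \<Rightarrow> real^'i \<Rightarrow> bool" where
  "einstein_equation d S a g A \<phi> x \<longleftrightarrow>
     (\<forall>i j. ricci g i j x =
        - real d * g x $ i $ j
        + 1/2 * ((\<Sum>r\<in>UNIV. \<Sum>s\<in>UNIV.
                    inv_metric g r s x * field_strength A i r x * field_strength A j s x)
                 - 1 / (2 * (real d - 1)) * field_strength_sq g A x * g x $ i $ j)
        + reduced_stress d S a g \<phi> i j x)"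

definition maxwell_equation ::
  "(real^'i::finite \<Rightarrow> real^'i^'i) \<Rightarrow> (real^'i \<Rightarrow> real^'i) \<Rightarrow> real^'i \<Rightarrow> bool" where
  "maxwell_equation g A x \<longleftrightarrow>
     (\<forall>j. (\<Sum>i\<in>UNIV. cov_deriv_bivector g (field_strength_up g A) i i j x) = 0)"

definition scalar_equation ::
  "real \<Rightarrow> (real^'i::finite \<Rightarrow> real^'i^'i) \<Rightarrow> (real^'i \<Rightarrow> real) \<Rightarrow> real^'i \<Rightarrow> bool" where
  "scalar_equation m g \<psi> x \<longleftrightarrow>
     (\<Sum>i\<in>UNIV. \<Sum>j\<in>UNIV. inv_metric g i j x
        * cov_deriv_covector g (\<lambda>k y. kinetic g \<psi> y powr (m - 1) * partial k \<psi> y) i j x) = 0"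

text \<open>Signature \<open>(-, +, \<dots>, +)\<close>; in particular such a matrix is symmetric and invertible.\<close>

definition minkowski :: "real^('n::finite coord)^('n coord)" where
  "minkowski = (\<chi> i j. if i \<noteq> j then 0 else if i = Time then - 1 else 1)"

definition lorentzian :: "real^('n::finite coord)^('n coord) \<Rightarrow> bool" where
  "lorentzian M \<longleftrightarrow> (\<exists>P :: real^('n coord)^('n coord). invertible P \<and> transpose P ** M ** P = minkowski)"

text \<open>Besides the field equations, a solution comprises what makes them meaningful: fields that
  can be differentiated twice, Lorentzian signature, and positive kinetic terms.\<close>

definition ems_solution_on ::
  "(real^('n::finite coord)) set \<Rightarrow> nat \<Rightarrow> real set \<Rightarrow> (real \<Rightarrow> real)
     \<Rightarrow> (real^('n coord) \<Rightarrow> real^('n coord)^('n coord)) \<Rightarrow> (real^('n coord) \<Rightarrow> real^('n coord))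
     \<Rightarrow> (real \<Rightarrow> 'n \<Rightarrow> real^('n coord) \<Rightarrow> real) \<Rightarrow> bool" where
  "ems_solution_on U d S a g A \<phi> \<longleftrightarrow>
     (\<forall>i j. twice_differentiable_on (\<lambda>x. g x $ i $ j) U) \<and>
     (\<forall>i. twice_differentiable_on (\<lambda>x. A x $ i) U) \<and>
     (\<forall>m\<in>S. \<forall>I. twice_differentiable_on (\<phi> m I) U) \<and>
     (\<forall>x\<in>U. lorentzian (g x)) \<and>
     (\<forall>x\<in>U. \<forall>m\<in>S. \<forall>I. kinetic g (\<phi> m I) x > 0) \<and>
     (\<forall>x\<in>U. einstein_equation d S a g A \<phi> x) \<and>
     (\<forall>x\<in>U. maxwell_equation g A x) \<and>
     (\<forall>x\<in>U. \<forall>m\<in>S. \<forall>I. scalar_equation m g (\<phi> m I) x)"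


section \<open>The explicit fields\<close>

definition blackening ::
  "nat \<Rightarrow> real set \<Rightarrow> (real \<Rightarrow> real) \<Rightarrow> (real \<Rightarrow> real) \<Rightarrow> real \<Rightarrow> real \<Rightarrow> real \<Rightarrow> real" where
  "blackening d S a c m0 \<mu> z =
     1 - m0 * z ^ d
     + (real d - 2) * \<mu>^2 / (2 * (real d - 1)) * z ^ (2 * (d - 1))
     + (\<Sum>m | m \<in> S \<and> 2 * m \<noteq> real d. a m / (2 * m - real d) * (c m * z) powr (2 * m))
     + (\<Sum>m | m \<in> S \<and> 2 * m = real d. a m * (c m * z) ^ d * ln z)"

definition brane_metric ::
  "(real \<Rightarrow> real) \<Rightarrow> real^('n::finite coord) \<Rightarrow> real^('n coord)^('n coord)" where
  "brane_metric F x =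
     (let z = x $ Radial in
      \<chi> i j. 1 / z^2 *
        (if i \<noteq> j then 0
         else case i of Time \<Rightarrow> - F z | Radial \<Rightarrow> 1 / F z | Space k \<Rightarrow> 1))"

definition gauge_potential :: "nat \<Rightarrow> real \<Rightarrow> real^('n::finite coord) \<Rightarrow> real^('n coord)" where
  "gauge_potential d \<mu> x = (\<chi> i. if i = Time then \<mu> * (1 - (x $ Radial) ^ (d - 2)) else 0)"

definition linear_scalar :: "(real \<Rightarrow> real) \<Rightarrow> real \<Rightarrow> 'n::finite \<Rightarrow> real^('n coord) \<Rightarrow> real" where
  "linear_scalar c m I x = c m * x $ Space I"

end

theory Submission
  imports Defs
begin

text \<open>The metric is diagonal and depends on \<open>z\<close> only, so with \<open>F\<close> arbitrary its Ricci tensor is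
  diagonal, with \<open>R\<^sub>x\<^sub>x / g\<^sub>x\<^sub>x = z F' - d F\<close> and
  \<open>R\<^sub>t\<^sub>t / g\<^sub>t\<^sub>t = R\<^sub>z\<^sub>z / g\<^sub>z\<^sub>z = - z\<^sup>2 F'' / 2 + (d + 1) / 2 * z F' - d F\<close>. Writing \<open>G = z F' - d F\<close>, the
  latter is \<open>G - z G' / 2\<close>. The spatial Einstein equation prescribes
  \<open>G = - d + E / (2 (d - 1)) + (\<Sum>m. Y m)\<close>, where \<open>E\<close> comes from the Maxwell field and \<open>Y m\<close> is
  \<open>a m (c m z)\<close> to the power \<open>2 m\<close>; the blackening function solves this linear equation, with a
  logarithm at the resonance \<open>2 m = d\<close>. The remaining Einstein equations then
  hold because \<open>z G' / 2 = E / 2 + (\<Sum>m. m * Y m)\<close>.\<close>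

subsection \<open>Sums over coordinates and radial functions\<close>

lemma UNIV_coord: "(UNIV :: 'n coord set) = insert Time (insert Radial (range Space))"
  using coord.exhaust by auto

lemma sum_coord:
  fixes f :: "'n::finite coord \<Rightarrow> real"
  shows "(\<Sum>i\<in>UNIV. f i) = f Time + f Radial + (\<Sum>k\<in>UNIV. f (Space k))"
proof -
  have "inj (Space :: 'n \<Rightarrow> 'n coord)" by (auto simp: inj_def)
  then have "(\<Sum>i\<in>range Space. f i) = (\<Sum>k\<in>UNIV. f (Space k))"
    by (simp add: sum.reindex)
  then show ?thesis
    by (simp add: UNIV_coord image_iff add.assoc)
qed

lemma partial_eqI:
  assumes "(f has_derivative f') (at x)" "f' (axis i 1) = c"
  shows "partial i f x = c"
  using assms by (metis frechet_derivative_at partial_def)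

text \<open>\<open>frechet_derivative\<close> is a choice among all \<open>has_derivative\<close>
  witnesses, and these depend only on the germ at \<open>x\<close>, so differentiability is not
  assumed. Needed because Christoffel symbols have closed forms only where the metric is
  invertible.\<close>

lemma partial_cong_open:
  assumes "open U" "x \<in> U" "\<And>y. y \<in> U \<Longrightarrow> f y = g y"
  shows "partial i f x = partial i g x"
proof -
  have "(f has_derivative D) (at x) \<longleftrightarrow> (g has_derivative D) (at x)" for D
    using has_derivative_transform_within_open[of f D x UNIV U g]
      has_derivative_transform_within_open[of g D x UNIV U f] assms by auto
  then show ?thesis by (simp add: partial_def frechet_derivative_def)
qed

lemma has_derivative_radial:
  fixes x :: "real^'i::finite"
  assumes "(f has_real_derivative D) (at (x $ \<rho>))"
  shows "((\<lambda>y. f (y $ \<rho>)) has_derivative (\<lambda>v. D * v $ \<rho>)) (at x)"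
proof -
  have "((\<lambda>y. y $ \<rho>) has_derivative (\<lambda>v. v $ \<rho>)) (at x)"
    by (rule bounded_linear.has_derivative[OF bounded_linear_vec_nth has_derivative_ident])
  from has_derivative_compose[OF this assms[unfolded has_field_derivative_def]]
  show ?thesis .
qed

lemma partial_radial:
  assumes "(f has_real_derivative D) (at (x $ \<rho>))"
  shows "partial i (\<lambda>y. f (y $ \<rho>)) x = (if i = \<rho> then D else 0)"
  by (rule partial_eqI[OF has_derivative_radial[OF assms]]) (auto simp: axis_def)

lemma partial_const [simp]: "partial i (\<lambda>y. c) x = 0"
  by (rule partial_eqI[OF has_derivative_const]) simp

lemma partial_linear_scalar:
  "partial i (linear_scalar c m I) x = (if i = Space I then c m else 0)"
proof -
  have "((\<lambda>z. c m * z) has_real_derivative c m) (at (x $ Space I))"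
    by (auto intro!: derivative_eq_intros)
  from partial_radial[OF this, of i] show ?thesis by (simp add: linear_scalar_def[abs_def])
qed

lemma twice_differentiable_on_const: "twice_differentiable_on (\<lambda>x. c) U"
  by (simp add: twice_differentiable_on_def partial_const[abs_def])

lemma twice_differentiable_on_radial:
  assumes "open U"
    and f: "\<And>x. x \<in> U \<Longrightarrow> (f has_real_derivative f' (x $ \<rho>)) (at (x $ \<rho>))"
    and f': "\<And>x. x \<in> U \<Longrightarrow> f' differentiable (at (x $ \<rho>))"
  shows "twice_differentiable_on (\<lambda>x. f (x $ \<rho>)) U"
  unfolding twice_differentiable_on_def
proof (intro conjI allI ballI)
  fix x assume x: "x \<in> U"
  show "(\<lambda>x. f (x $ \<rho>)) differentiable at x"
    using has_derivative_radial[OF f[OF x]] by (auto simp: differentiable_def)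
  fix i
  obtain D where "(f' has_real_derivative D) (at (x $ \<rho>))"
    using f'[OF x] by (auto simp: real_differentiable_def)
  then have "((\<lambda>y. if i = \<rho> then f' (y $ \<rho>) else 0) has_derivative
      (\<lambda>v. if i = \<rho> then D * v $ \<rho> else 0)) (at x)"
    by (cases "i = \<rho>") (auto intro: has_derivative_radial)
  then have "(partial i (\<lambda>x. f (x $ \<rho>)) has_derivative
      (\<lambda>v. if i = \<rho> then D * v $ \<rho> else 0)) (at x)"
    by (rule has_derivative_transform_within_open[OF _ \<open>open U\<close> x])
       (simp add: partial_radial[OF f])
  then show "partial i (\<lambda>x. f (x $ \<rho>)) differentiable at x"
    by (auto simp: differentiable_def)
qed

subsection \<open>Diagonal metrics depending on one coordinate\<close>

text \<open>Index type and distinguished coordinate stay abstract, so the curvature computation is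
  uniform; the split into \<open>Time\<close>, \<open>Radial\<close> and \<open>Space\<close> is
  postponed to the brane metric.\<close>

definition diag_metric :: "'i \<Rightarrow> ('i \<Rightarrow> real \<Rightarrow> real) \<Rightarrow> real^'i \<Rightarrow> real^'i^'i::finite" where
  "diag_metric \<rho> w x = (\<chi> i j. if i = j then w i (x $ \<rho>) else 0)"

lemma diag_metric_nth [simp]:
  "diag_metric \<rho> w x $ i $ j = (if i = j then w i (x $ \<rho>) else 0)"
  by (simp add: diag_metric_def)

text \<open>\<open>matrix_inv\<close> chooses some two-sided inverse. For square matrices a right
  inverse is two-sided, and associativity makes it unique.\<close>

lemma matrix_inv_eqI:
  fixes A B :: "real^'i::finite^'i"
  assumes "A ** B = mat 1"
  shows "matrix_inv A = B"
proof -
  have BA: "B ** A = mat 1" using assms by (simp add: matrix_left_right_inverse)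
  have "A ** matrix_inv A = mat 1"
    unfolding matrix_inv_def by (rule someI2[of _ B]) (use assms BA in auto)
  then have "B ** (A ** matrix_inv A) = B" by simp
  then show ?thesis by (simp add: matrix_mul_assoc BA)
qed

lemma inv_metric_diag:
  assumes "\<And>i. w i (x $ \<rho>) \<noteq> 0"
  shows "inv_metric (diag_metric \<rho> w) i j x = (if i = j then 1 / w i (x $ \<rho>) else 0)"
proof -
  define B where "B = (\<chi> i j. if i = j then 1 / w i (x $ \<rho>) else 0)"
  have "diag_metric \<rho> w x ** B = mat 1"
    using assms by (auto simp: matrix_matrix_mult_def mat_def vec_eq_iff B_def
        if_distrib[of "\<lambda>u. u * _"] if_distrib[of "\<lambda>u. _ * u"] cong: if_cong)
  then have "matrix_inv (diag_metric \<rho> w x) = B"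
    by (rule matrix_inv_eqI)
  then show ?thesis by (simp add: inv_metric_def B_def)
qed

text \<open>A derivative of a metric component survives only along \<open>\<rho>\<close> and on the
  diagonal, and the sum over \<open>s\<close> collapses to \<open>s = r\<close>. The three
  conditions overlap at \<open>r = i = j = \<rho>\<close>, where the terms add up as 1 + 1 -
  1.\<close>

lemma christoffel_diag:
  assumes "\<And>i. w i (x $ \<rho>) \<noteq> 0"
    and "\<And>i. (w i has_real_derivative D i) (at (x $ \<rho>))"
  shows "christoffel (diag_metric \<rho> w) r i j x =
    (if i = \<rho> \<and> r = j then D r / (2 * w r (x $ \<rho>)) else 0)
    + (if j = \<rho> \<and> r = i then D r / (2 * w r (x $ \<rho>)) else 0)
    - (if r = \<rho> \<and> i = j then D i / (2 * w \<rho> (x $ \<rho>)) else 0)"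
proof -
  have *: "partial k (\<lambda>y. if p = q then w p (y $ \<rho>) else 0) x
      = (if k = \<rho> \<and> p = q then D p else 0)" for k p q
    using partial_radial[OF assms(2)] by (cases "p = q") auto
  show ?thesis
    unfolding christoffel_def inv_metric_diag[where w=w and x=x and \<rho>=\<rho>, OF assms(1)] diag_metric_nth *
    by (simp add: if_distrib[of "\<lambda>u. u * _"] field_simps cong: if_cong)
qed

text \<open>With \<open>h i = w i' / (2 w i)\<close> and \<open>k i = w i' / (2 w \<rho>)\<close> the only Christoffel symbols are
  \<open>\<Gamma>\<^sup>i\<^sub>\<rho>\<^sub>i = h i\<close> and \<open>\<Gamma>\<^sup>\<rho>\<^sub>i\<^sub>i = - k i\<close> for \<open>i \<noteq> \<rho>\<close>, besides \<open>\<Gamma>\<^sup>\<rho>\<^sub>\<rho>\<^sub>\<rho> = h \<rho> = k \<rho>\<close>.\<close>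

lemma ricci_diag:
  fixes h k :: "'i::finite \<Rightarrow> real \<Rightarrow> real" and x :: "real^'i"
  assumes "open V" "x $ \<rho> \<in> V"
    and w: "\<And>i z. z \<in> V \<Longrightarrow> w i z \<noteq> 0"
    and D: "\<And>i z. z \<in> V \<Longrightarrow> (w i has_real_derivative D i z) (at z)"
    and h: "\<And>i z. z \<in> V \<Longrightarrow> h i z = D i z / (2 * w i z)"
    and k: "\<And>i z. z \<in> V \<Longrightarrow> k i z = D i z / (2 * w \<rho> z)"
    and h': "\<And>i. (h i has_real_derivative h' i) (at (x $ \<rho>))"
    and k': "\<And>i. (k i has_real_derivative k' i) (at (x $ \<rho>))"
  defines "z \<equiv> x $ \<rho>"
  shows "ricci (diag_metric \<rho> w) i j x =
    (if i \<noteq> j then 0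
     else if i = \<rho> then h' \<rho> - (\<Sum>r\<in>UNIV. h' r) + (\<Sum>r\<in>UNIV. h r z) * h \<rho> z - (\<Sum>r\<in>UNIV. (h r z)\<^sup>2)
     else - k' i - (\<Sum>r\<in>UNIV. h r z) * k i z + 2 * h i z * k i z)"
proof -
  let ?U = "(\<lambda>y. y $ \<rho>) -` V" let ?g = "diag_metric \<rho> w"
  have U: "open ?U" "x \<in> ?U"
    using assms(1,2) by (auto intro!: open_vimage continuous_intros)
  define \<Gamma> where "\<Gamma> r i j t = (if i = \<rho> \<and> r = j then h r t else 0)
    + (if j = \<rho> \<and> r = i then h r t else 0) - (if r = \<rho> \<and> i = j then k i t else 0)" for r i j t
  have chr: "christoffel ?g r i j y = \<Gamma> r i j (y $ \<rho>)" if "y \<in> ?U" for r i j y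
  proof -
    have y: "y $ \<rho> \<in> V" using that by simp
    show ?thesis
      unfolding \<Gamma>_def h[OF y] k[OF y] by (rule christoffel_diag[OF w[OF y] D[OF y]])
  qed
  define \<Gamma>' where "\<Gamma>' r i j = (if i = \<rho> \<and> r = j then h' r else 0)
    + (if j = \<rho> \<and> r = i then h' r else 0) - (if r = \<rho> \<and> i = j then k' i else 0)" for r i j
  have "(\<Gamma> r i j has_real_derivative \<Gamma>' r i j) (at (x $ \<rho>))" for r i j
    unfolding \<Gamma>_def \<Gamma>'_def
    by (intro DERIV_diff DERIV_add) (auto intro: h' k')
  from partial_radial[OF this]
  have pchr: "partial s (christoffel ?g r i j) x = (if s = \<rho> then \<Gamma>' r i j else 0)" for s r i j
    using partial_cong_open[OF U chr] by simp
  have hk: "h \<rho> z = k \<rho> z" using assms by (simp add: h k)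
  \<comment> \<open>\<open>h \<rho>\<close> and \<open>k \<rho>\<close> agree only on
    \<open>V\<close>; uniqueness of the derivative identifies their separately given derivatives at
    the point.\<close>
  have hk': "h' \<rho> = k' \<rho>"
  proof -
    have "(h \<rho> has_real_derivative k' \<rho>) (at (x $ \<rho>))"
      by (rule has_field_derivative_transform_within_open[OF k' assms(1,2)]) (simp add: h k)
    with h' show ?thesis by (rule DERIV_unique)
  qed
  \<comment> \<open>At \<open>r = l = \<rho>\<close> the symbol is h + h - k, which
    \<open>hk\<close> reduces to h.\<close>
  have tr: "\<Gamma> r r l z = (if l = \<rho> then h r z else 0)" for r l
    using hk by (auto simp: \<Gamma>_def)
  have tr': "\<Gamma>' r r l = (if l = \<rho> then h' r else 0)" for r l
    using hk' by (auto simp: \<Gamma>'_def)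
  have "ricci ?g i j x = (\<Sum>r\<in>UNIV. (if r = \<rho> then \<Gamma>' r j i else 0)
      - (if j = \<rho> then \<Gamma>' r r i else 0)
      + (\<Sum>l\<in>UNIV. \<Gamma> r r l z * \<Gamma> l j i z - \<Gamma> r j l z * \<Gamma> l r i z))"
    using U(2) by (simp add: ricci_def riemann_def pchr chr z_def)
  also have "\<dots> = \<Gamma>' \<rho> j i - (if j = \<rho> \<and> i = \<rho> then (\<Sum>r\<in>UNIV. h' r) else 0)
      + (\<Sum>r\<in>UNIV. h r z) * \<Gamma> \<rho> j i z - (\<Sum>r\<in>UNIV. \<Sum>l\<in>UNIV. \<Gamma> r j l z * \<Gamma> l r i z)"
    by (simp add: sum.distrib sum_subtractf tr tr' if_distrib[of "\<lambda>u. u * _"] sum_distrib_right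
        cong: if_cong)
  \<comment> \<open>View \<open>\<Gamma> r j l\<close> as a matrix in r and l. For
    \<open>j = \<rho>\<close> it is diagonal with entries h. Otherwise it has just two entries,
    \<open>h j\<close> at \<open>(j, \<rho>)\<close> and \<open>- k j\<close> at
    \<open>(\<rho>, j)\<close>, each contributing \<open>- h j * k j\<close> when
    \<open>i = j\<close>.\<close>
  also have "(\<Sum>r\<in>UNIV. \<Sum>l\<in>UNIV. \<Gamma> r j l z * \<Gamma> l r i z) =
     (if i \<noteq> j then 0 else if i = \<rho> then (\<Sum>r\<in>UNIV. (h r z)\<^sup>2) else - 2 * h i z * k i z)"
  proof -
    have *: "\<Gamma> r \<rho> l z = (if r = l then h r z else 0)" for r l
      using hk by (auto simp: \<Gamma>_def)
    have sym: "\<Gamma> r s l z = \<Gamma> r l s z" for r s l by (auto simp: \<Gamma>_def)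
    have **: "\<Gamma> r s l z = (if l = \<rho> \<and> r = s then h s z else 0) - (if r = \<rho> \<and> l = s then k s z else 0)"
      if "s \<noteq> \<rho>" for r s l using that by (auto simp: \<Gamma>_def)
    show ?thesis
    proof (cases "j = \<rho>")
      case True
      then have "(\<Sum>r\<in>UNIV. \<Sum>l\<in>UNIV. \<Gamma> r j l z * \<Gamma> l r i z) = (\<Sum>r\<in>UNIV. h r z * \<Gamma> r r i z)"
        by (simp add: * if_distrib[of "\<lambda>u. u * _"] cong: if_cong)
      then show ?thesis using True by (auto simp: tr power2_eq_square)
    next
      case False
      have "(\<Sum>l\<in>UNIV. \<Gamma> r j l z * \<Gamma> l r i z) =
          (if r = j then h j z * \<Gamma> \<rho> j i z else 0) - (if r = \<rho> then k j z * \<Gamma> j \<rho> i z else 0)" for r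
      proof -
        have "\<Gamma> r j l z * \<Gamma> l r i z = (if l = \<rho> then (if r = j then h j z * \<Gamma> l r i z else 0) else 0)
           - (if l = j then (if r = \<rho> then k j z * \<Gamma> l r i z else 0) else 0)" for l
          by (simp add: **[OF False] left_diff_distrib)
        then show ?thesis by (simp add: sum_subtractf)
      qed
      then have "(\<Sum>r\<in>UNIV. \<Sum>l\<in>UNIV. \<Gamma> r j l z * \<Gamma> l r i z) =
          h j z * \<Gamma> \<rho> j i z - k j z * \<Gamma> j \<rho> i z"
        by (simp add: sum_subtractf)
      then show ?thesis using False by (auto simp: * **[OF False])
    qed
  qed
  finally show ?thesis
    using hk hk' by (auto simp: \<Gamma>_def \<Gamma>'_def)
qed

text \<open>Rescaling each coordinate by the inverse square root of the absolute value of its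
  coefficient turns every diagonal entry into its sign.\<close>

lemma lorentzian_diag:
  assumes "w Time (x $ \<rho>) < 0" "\<And>i. i \<noteq> Time \<Longrightarrow> w i (x $ \<rho>) > 0"
  shows "lorentzian (diag_metric \<rho> w x)"
proof -
  let ?u = "\<lambda>i. w i (x $ \<rho>)"
  have nz: "?u i \<noteq> 0" for i using assms by (metis less_irrefl)
  define P where "P = (\<chi> i j. if i = j then 1 / sqrt \<bar>?u i\<bar> else 0)"
  define Q where "Q = (\<chi> i j. if i = j then sqrt \<bar>?u i\<bar> else 0)"
  have "Q ** P = mat 1"
    using nz by (auto simp: matrix_matrix_mult_def mat_def vec_eq_iff P_def Q_def
        if_distrib[of "\<lambda>u. u * _"] if_distrib[of "\<lambda>u. _ * u"] cong: if_cong)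
  then have "invertible P" by (auto simp: invertible_left_inverse)
  moreover have "(1 / sqrt \<bar>?u i\<bar>) * ?u i * (1 / sqrt \<bar>?u i\<bar>) = (if i = Time then - 1 else 1)" for i
    using assms(1) assms(2)[of i] by (auto simp: field_simps)
  then have "transpose P ** diag_metric \<rho> w x ** P = minkowski"
    by (auto simp: matrix_matrix_mult_def minkowski_def vec_eq_iff P_def transpose_def
        if_distrib[of "\<lambda>u. u * _"] if_distrib[of "\<lambda>u. _ * u"] cong: if_cong)
  ultimately show ?thesis unfolding lorentzian_def by blast
qed

subsection \<open>Ricci curvature of the brane metric\<close>

definition brane_coeff :: "(real \<Rightarrow> real) \<Rightarrow> 'n::finite coord \<Rightarrow> real \<Rightarrow> real" where
  "brane_coeff F i z = (case i of Time \<Rightarrow> - F z / z\<^sup>2 | Radial \<Rightarrow> 1 / (F z * z\<^sup>2) | Space k \<Rightarrow> 1 / z\<^sup>2)"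

lemma brane_coeff_simps [simp]:
  "brane_coeff F Time z = - F z / z\<^sup>2"
  "brane_coeff F Radial z = 1 / (F z * z\<^sup>2)"
  "brane_coeff F (Space k) z = 1 / z\<^sup>2"
  by (simp_all add: brane_coeff_def)

lemma brane_metric_eq_diag: "brane_metric F = diag_metric Radial (brane_coeff F)"
  by (auto simp: fun_eq_iff vec_eq_iff brane_metric_def brane_coeff_def Let_def split: coord.split)

definition brane_coeff_deriv :: "(real \<Rightarrow> real) \<Rightarrow> (real \<Rightarrow> real) \<Rightarrow> 'n::finite coord \<Rightarrow> real \<Rightarrow> real" where
  "brane_coeff_deriv F F' i z = (case i of Time \<Rightarrow> 2 * F z / z^3 - F' z / z\<^sup>2
    | Radial \<Rightarrow> - 2 / (z^3 * F z) - F' z / (z\<^sup>2 * (F z)\<^sup>2) | Space k \<Rightarrow> - 2 / z^3)"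

lemma brane_coeff_has_derivative:
  assumes "z > 0" "F z > 0" "(F has_real_derivative F' z) (at z)"
  shows "(brane_coeff F i has_real_derivative brane_coeff_deriv F F' i z) (at z)"
  using assms(1,2) by (cases i)
    (auto simp: brane_coeff_def[abs_def] brane_coeff_deriv_def field_simps power2_eq_square
      power3_eq_cube intro!: derivative_eq_intros assms(3))

text \<open>The number \<open>n\<close> of spatial directions enters through the traces in
  \<open>ricci_diag\<close>; in the application \<open>n + 1\<close> is d.\<close>

lemma ricci_brane:
  fixes x :: "real^('n::finite coord)"
  assumes "open V" "x $ Radial \<in> V"
    and V: "\<And>z. z \<in> V \<Longrightarrow> z > 0 \<and> F z > 0"
    and F': "\<And>z. z \<in> V \<Longrightarrow> (F has_real_derivative F' z) (at z)"
    and F'': "(F' has_real_derivative F'') (at (x $ Radial))"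
  defines "z \<equiv> x $ Radial" and "n \<equiv> real CARD('n)"
  shows "ricci (brane_metric F) i j x = (if i \<noteq> j then 0 else brane_coeff F i z *
     (case i of Space k \<Rightarrow> z * F' z - (n + 1) * F z
      | _ \<Rightarrow> - z\<^sup>2 * F'' / 2 + (n + 2) / 2 * z * F' z - (n + 1) * F z))"
proof -
  let ?D = "brane_coeff_deriv F F' :: 'n coord \<Rightarrow> _"
  \<comment> \<open>Half the logarithmic derivatives of the coefficients, simplified so that they
    can be differentiated again.\<close>
  let ?h = "\<lambda>(i::'n coord) z. case i of Time \<Rightarrow> F' z / (2 * F z) - 1 / z
    | Radial \<Rightarrow> - F' z / (2 * F z) - 1 / z | Space k \<Rightarrow> - 1 / z"
  let ?k = "\<lambda>(i::'n coord) z. case i of Time \<Rightarrow> (F z)\<^sup>2 / z - F z * F' z / 2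
    | Radial \<Rightarrow> - F' z / (2 * F z) - 1 / z | Space k \<Rightarrow> - F z / z"
  let ?h' = "\<lambda>(i::'n coord). case i of Time \<Rightarrow> F'' / (2 * F z) - (F' z)\<^sup>2 / (2 * (F z)\<^sup>2) + 1 / z\<^sup>2
    | Radial \<Rightarrow> - F'' / (2 * F z) + (F' z)\<^sup>2 / (2 * (F z)\<^sup>2) + 1 / z\<^sup>2 | Space k \<Rightarrow> 1 / z\<^sup>2"
  let ?k' = "\<lambda>(i::'n coord). case i of
      Time \<Rightarrow> 2 * F z * F' z / z - (F z)\<^sup>2 / z\<^sup>2 - (F' z)\<^sup>2 / 2 - F z * F'' / 2
    | Radial \<Rightarrow> - F'' / (2 * F z) + (F' z)\<^sup>2 / (2 * (F z)\<^sup>2) + 1 / z\<^sup>2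
    | Space k \<Rightarrow> - F' z / z + F z / z\<^sup>2"
  have zV: "z > 0" "F z > 0" using V assms(2) by (auto simp: z_def)
  note [derivative_intros] = F'[OF assms(2), folded z_def] F''[folded z_def]
  have "ricci (diag_metric Radial (brane_coeff F)) i j x =
    (if i \<noteq> j then 0
     else if i = Radial then ?h' Radial - (\<Sum>r\<in>UNIV. ?h' r) + (\<Sum>r\<in>UNIV. ?h r z) * ?h Radial z
       - (\<Sum>r\<in>UNIV. (?h r z)\<^sup>2)
     else - ?k' i - (\<Sum>r\<in>UNIV. ?h r z) * ?k i z + 2 * ?h i z * ?k i z)"
    unfolding z_def
  proof (rule ricci_diag[OF assms(1,2), where D = ?D], unfold z_def[symmetric])
    fix i :: "'n coord" and y assume "y \<in> V"
    then have y: "y > 0" "F y > 0" and Fy: "(F has_real_derivative F' y) (at y)"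
      using V F' by auto
    show "brane_coeff F i y \<noteq> 0" using y by (cases i) auto
    show "(brane_coeff F i has_real_derivative ?D i y) (at y)"
      using y Fy by (rule brane_coeff_has_derivative)
    show "?h i y = ?D i y / (2 * brane_coeff F i y)"
      using y by (cases i) (auto simp: brane_coeff_deriv_def field_simps power2_eq_square power3_eq_cube)
    show "?k i y = ?D i y / (2 * brane_coeff F Radial y)"
      using y by (cases i) (auto simp: brane_coeff_deriv_def field_simps power2_eq_square power3_eq_cube)
  next
    fix i :: "'n coord"
    show "(?h i has_real_derivative ?h' i) (at z)"
      using zV by (cases i) (auto simp: field_simps power2_eq_square intro!: derivative_eq_intros)
    show "(?k i has_real_derivative ?k' i) (at z)"
      using zV by (cases i) (auto simp: field_simps power2_eq_square intro!: derivative_eq_intros)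
  qed
  \<comment> \<open>In the traces the F-dependent parts of \<open>Time\<close> and
    \<open>Radial\<close> cancel: \<open>?h\<close> sums to -(n + 2)/z and \<open>?h'\<close> to (n
    + 2)/z^2.\<close>
  also have "\<dots> = (if i \<noteq> j then 0 else brane_coeff F i z *
     (case i of Space k \<Rightarrow> z * F' z - (n + 1) * F z
      | _ \<Rightarrow> - z\<^sup>2 * F'' / 2 + (n + 2) / 2 * z * F' z - (n + 1) * F z))"
    using zV by (cases i) (auto simp: sum_coord n_def[symmetric] field_simps power2_eq_square)
  finally show ?thesis by (simp add: brane_metric_eq_diag)
qed

subsection \<open>The first-order equation for the blackening function\<close>

text \<open>This is G = z F' - d F in closed form. The term with \<open>m0\<close> drops out because
  z^d solves the homogeneous equation, and the second factor d - 2 is 2(d - 1) - d.\<close>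

definition blackening_source ::
  "nat \<Rightarrow> real set \<Rightarrow> (real \<Rightarrow> real) \<Rightarrow> (real \<Rightarrow> real) \<Rightarrow> real \<Rightarrow> real \<Rightarrow> real" where
  "blackening_source d S a c \<mu> z = - real d
     + (real d - 2)\<^sup>2 * \<mu>\<^sup>2 / (2 * (real d - 1)) * z ^ (2 * (d - 1))
     + (\<Sum>m\<in>S. a m * (c m * z) powr (2 * m))"

lemma has_real_derivative_scaled_powr:
  assumes "c > 0" "z > 0"
  shows "((\<lambda>z. (c * z) powr p) has_real_derivative p / z * (c * z) powr p) (at z)"
  using assms by (auto intro!: derivative_eq_intros simp: powr_diff field_simps)

lemma blackening_source_deriv:
  assumes "d \<ge> 3" "\<forall>m\<in>S. c m > 0" "z > 0"
  shows "(blackening_source d S a c \<mu> has_real_derivative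
     ((real d - 2)\<^sup>2 * \<mu>\<^sup>2 * z ^ (2 * (d - 1)) + (\<Sum>m\<in>S. 2 * m * (a m * (c m * z) powr (2 * m)))) / z)
     (at z)"
proof -
  have *: "((\<lambda>z. \<Sum>m\<in>S. a m * (c m * z) powr (2 * m)) has_real_derivative
      (\<Sum>m\<in>S. a m * (2 * m / z * (c m * z) powr (2 * m)))) (at z)"
    using assms by (intro DERIV_sum DERIV_cmult has_real_derivative_scaled_powr) auto
  have "((\<lambda>z. z ^ (2 * (d - 1))) has_real_derivative (2 * (real d - 1)) * z ^ (2 * (d - 1)) / z) (at z)"
    using assms by (auto intro!: derivative_eq_intros simp: power_diff of_nat_diff)
  note ** = DERIV_cmult[OF this, of "(real d - 2)\<^sup>2 * \<mu>\<^sup>2 / (2 * (real d - 1))"]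
  show ?thesis
    unfolding blackening_source_def[abs_def]
    by (rule DERIV_cong[OF DERIV_add[OF DERIV_add[OF DERIV_const **] *]])
       (use assms in \<open>simp add: add_divide_distrib sum_divide_distrib mult_ac\<close>)
qed

text \<open>The operator z d/dz - d multiplies z^p by p - d, which explains the denominators 2m - d
  in \<open>blackening\<close>. At the resonance p = d this factor vanishes, and z^d ln z is sent to
  z^d instead.\<close>

lemma blackening_deriv:
  assumes "d \<ge> 3" "finite S" "\<forall>m\<in>S. c m > 0" "z > 0"
  shows "(blackening d S a c m0 \<mu> has_real_derivative
     (blackening_source d S a c \<mu> z + real d * blackening d S a c m0 \<mu> z) / z) (at z)"
proof -
  let ?A = "{m. m \<in> S \<and> 2 * m \<noteq> real d}" and ?B = "{m. m \<in> S \<and> 2 * m = real d}"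
  have pw: "((\<lambda>z. z ^ k) has_real_derivative real k * z ^ k / z) (at z)" for k
    by (rule DERIV_cong[OF DERIV_pow]) (use assms in \<open>cases k; simp\<close>)
  have 1: "((\<lambda>z. 1 - m0 * z ^ d) has_real_derivative - m0 * (real d * z ^ d / z)) (at z)"
    by (rule DERIV_cong[OF DERIV_diff[OF DERIV_const DERIV_cmult[OF pw]]]) simp
  have 2: "((\<lambda>z. (real d - 2) * \<mu>^2 / (2 * (real d - 1)) * z ^ (2 * (d - 1))) has_real_derivative
      (real d - 2) * \<mu>^2 / (2 * (real d - 1)) * (real (2 * (d - 1)) * z ^ (2 * (d - 1)) / z)) (at z)"
    by (intro DERIV_cmult pw)
  have 3: "((\<lambda>z. \<Sum>m\<in>?A. a m / (2 * m - real d) * (c m * z) powr (2 * m)) has_real_derivative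
      (\<Sum>m\<in>?A. a m / (2 * m - real d) * (2 * m / z * (c m * z) powr (2 * m)))) (at z)"
    using assms by (intro DERIV_sum DERIV_cmult has_real_derivative_scaled_powr) auto
  have 4: "((\<lambda>z. \<Sum>m\<in>?B. a m * (c m * z) ^ d * ln z) has_real_derivative
      (\<Sum>m\<in>?B. (a m * (c m * z) ^ d + real d * (a m * (c m * z) ^ d * ln z)) / z)) (at z)"
  proof (rule DERIV_sum)
    fix m
    have "((\<lambda>z. a m * c m ^ d * (z ^ d * ln z)) has_real_derivative
        a m * c m ^ d * (real d * z ^ d / z * ln z + z ^ d / z)) (at z)"
      by (rule DERIV_cong[OF DERIV_cmult[OF DERIV_mult[OF pw DERIV_ln_divide[OF assms(4)]]]]) simp
    then show "((\<lambda>z. a m * (c m * z) ^ d * ln z) has_real_derivative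
        (a m * (c m * z) ^ d + real d * (a m * (c m * z) ^ d * ln z)) / z) (at z)"
      by (simp add: power_mult_distrib add_divide_distrib distrib_left ac_simps)
  qed
  have A: "(\<Sum>m\<in>?A. a m / (2 * m - real d) * (2 * m / z * (c m * z) powr (2 * m))) =
     ((\<Sum>m\<in>?A. a m * (c m * z) powr (2 * m))
       + real d * (\<Sum>m\<in>?A. a m / (2 * m - real d) * (c m * z) powr (2 * m))) / z"
    unfolding sum_distrib_left sum.distrib[symmetric] sum_divide_distrib
    by (rule sum.cong) (use assms in \<open>auto simp: divide_simps\<close>, simp_all add: algebra_simps)
  \<comment> \<open>On \<open>?B\<close> one has 2m = d, so the natural power in the logarithmic
    term and the real power in the source agree.\<close>
  have B: "(\<Sum>m\<in>?B. (a m * (c m * z) ^ d + real d * (a m * (c m * z) ^ d * ln z)) / z) =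
     ((\<Sum>m\<in>?B. a m * (c m * z) powr (2 * m)) + real d * (\<Sum>m\<in>?B. a m * (c m * z) ^ d * ln z)) / z"
    unfolding sum_distrib_left sum.distrib[symmetric] sum_divide_distrib
    by (rule sum.cong) (use assms in \<open>auto simp: powr_realpow\<close>)
  have C: "(\<Sum>m\<in>S. a m * (c m * z) powr (2 * m)) =
      (\<Sum>m\<in>?A. a m * (c m * z) powr (2 * m)) + (\<Sum>m\<in>?B. a m * (c m * z) powr (2 * m))"
    by (subst sum.union_disjoint[symmetric]) (use assms(2) in \<open>auto intro!: sum.cong\<close>)
  have Q: "(real d - 2) * \<mu>^2 / (2 * (real d - 1)) * (real (2 * (d - 1)) * z ^ (2 * (d - 1)) / z) =
     ((real d - 2)\<^sup>2 * \<mu>\<^sup>2 / (2 * (real d - 1)) * z ^ (2 * (d - 1))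
      + real d * ((real d - 2) * \<mu>^2 / (2 * (real d - 1)) * z ^ (2 * (d - 1)))) / z"
    using assms by (simp add: of_nat_diff divide_simps) (simp add: algebra_simps power2_eq_square)
  show ?thesis
    unfolding blackening_def[abs_def]
    by (rule DERIV_cong[OF DERIV_add[OF DERIV_add[OF DERIV_add[OF 1 2] 3] 4]])
       (unfold A B Q blackening_source_def C, simp add: add_divide_distrib diff_divide_distrib algebra_simps)
qed

subsection \<open>Matter fields\<close>

lemma inv_metric_brane:
  fixes x :: "real^('n::finite coord)"
  assumes "x $ Radial > 0" "F (x $ Radial) > 0"
  shows "inv_metric (brane_metric F) i j x = (if i = j then 1 / brane_coeff F i (x $ Radial) else 0)"
  unfolding brane_metric_eq_diag
proof (rule inv_metric_diag)
  fix i :: "'n coord"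
  show "brane_coeff F i (x $ Radial) \<noteq> 0" using assms by (cases i) auto
qed

lemma brane_metric_nth:
  "brane_metric F x $ i $ j = (if i = j then brane_coeff F i (x $ Radial) else 0)"
  by (simp add: brane_metric_eq_diag)

lemma kinetic_brane:
  assumes "x $ Radial > 0" "F (x $ Radial) > 0"
  shows "kinetic (brane_metric F) (linear_scalar c m I) x = (c m * x $ Radial)\<^sup>2"
  by (simp add: kinetic_def inv_metric_brane[of x F, OF assms] partial_linear_scalar
      if_distrib[of "\<lambda>u. u * _"] if_distrib[of "\<lambda>u. _ * u"] power2_eq_square cong: if_cong)

text \<open>Each gradient points along one \<open>x^I\<close> with equal strength, so summing over I
  gives an isotropic spatial contribution m Y; the part proportional to the metric is counted once
  per I.\<close>

lemma stress_brane:
  fixes x :: "real^('n::finite coord)" and a c :: "real \<Rightarrow> real"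
  assumes x: "x $ Radial > 0" "F (x $ Radial) > 0" and "\<forall>m\<in>S. c m > 0"
  defines "z \<equiv> x $ Radial" and "Y \<equiv> \<lambda>m. a m * (c m * x $ Radial) powr (2 * m)"
  shows "stress S a (brane_metric F) (linear_scalar c) i j x = (if i \<noteq> j then 0 else
    brane_coeff F i z * ((case i of Space k \<Rightarrow> (\<Sum>m\<in>S. m * Y m) | _ \<Rightarrow> 0)
      - real CARD('n) / 2 * (\<Sum>m\<in>S. Y m)))"
proof -
  have "(\<Sum>I\<in>UNIV. 2 * m * a m * ((c m * z)\<^sup>2) powr (m - 1)
         * partial i (linear_scalar c m I) x * partial j (linear_scalar c m I) x
       - a m * ((c m * z)\<^sup>2) powr m * brane_metric F x $ i $ j)
     = (if i \<noteq> j then 0 else brane_coeff F i z *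
         (2 * (case i of Space k \<Rightarrow> m * Y m | _ \<Rightarrow> 0) - real CARD('n) * Y m))"
    if "m \<in> S" for m
  proof -
    have cz: "c m * z > 0" using that assms by auto
    then have 1: "((c m * z)\<^sup>2) powr m = (c m * z) powr (2 * m)"
      using powr_powr[of "c m * z" 2 m] powr_realpow[OF cz, of 2] by simp
    \<comment> \<open>The kinetic term is X = (c z)^2, hence X^(m-1) c^2 = X^m / z^2, and 1/z^2 is
      the spatial metric coefficient.\<close>
    have 2: "((c m * z)\<^sup>2) powr (m - 1) * c m * c m = (c m * z) powr (2 * m) / z\<^sup>2"
    proof -
      have "((c m * z)\<^sup>2) powr (m - 1) = (c m * z) powr (2 * m) / (c m * z)\<^sup>2"
        unfolding 1[symmetric] using cz by (simp add: powr_diff)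
      then show ?thesis using cz by (simp add: field_simps power2_eq_square)
    qed
    have 3: "(\<Sum>I\<in>UNIV. 2 * m * a m * ((c m * z)\<^sup>2) powr (m - 1)
         * partial i (linear_scalar c m I) x * partial j (linear_scalar c m I) x)
       = (if i \<noteq> j then 0 else brane_coeff F i z * (2 * (case i of Space k \<Rightarrow> m * Y m | _ \<Rightarrow> 0)))"
    proof (cases "\<exists>k. i = Space k \<and> j = i")
      case True
      then obtain k where k: "i = Space k" "j = Space k" by auto
      have "(\<Sum>I\<in>UNIV. 2 * m * a m * ((c m * z)\<^sup>2) powr (m - 1)
         * partial i (linear_scalar c m I) x * partial j (linear_scalar c m I) x)
        = 2 * m * a m * (((c m * z)\<^sup>2) powr (m - 1) * c m * c m)"
        by (simp add: k partial_linear_scalar if_distrib[of "\<lambda>u. _ * u"] cong: if_cong)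
      then show ?thesis unfolding 2 using k by (simp add: Y_def z_def)
    next
      case False
      then show ?thesis
        by (auto simp: partial_linear_scalar split: coord.split intro!: sum.neutral)
    qed
    show ?thesis
      unfolding sum_subtractf 3 1
      by (simp add: brane_metric_nth algebra_simps Y_def flip: z_def)
  qed
  then have st: "stress S a (brane_metric F) (linear_scalar c) i j x =
      1 / 2 * (\<Sum>m\<in>S. if i \<noteq> j then 0 else brane_coeff F i z *
         (2 * (case i of Space k \<Rightarrow> m * Y m | _ \<Rightarrow> 0) - real CARD('n) * Y m))"
    unfolding stress_def kinetic_brane[of x F, OF x] z_def[symmetric]
    by (intro arg_cong[where f = "\<lambda>u. 1 / 2 * u"] sum.cong refl)
  define q where "q = brane_coeff F i z"
  have lin: "(\<Sum>m\<in>S. q * (2 * t m - real CARD('n) * Y m))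
      = q * (2 * (\<Sum>m\<in>S. t m) - real CARD('n) * (\<Sum>m\<in>S. Y m))" for t
    by (simp add: sum_distrib_left sum_subtractf right_diff_distrib)
  show ?thesis
    using lin[of "\<lambda>m. m * Y m"] lin[of "\<lambda>m. 0"]
    unfolding st q_def[symmetric] by (cases i; auto simp: field_simps)
qed

text \<open>With n = d - 1 the trace divided by n is Q - (n + 2)/2 P, where P and Q are the sums of
  Y and m Y. Subtracting it turns -n/2 P into P and moves Q, with opposite sign, from the spatial
  entries to the other two.\<close>

lemma reduced_stress_brane:
  fixes x :: "real^('n::finite coord)" and a c :: "real \<Rightarrow> real"
  assumes x: "x $ Radial > 0" "F (x $ Radial) > 0" and "\<forall>m\<in>S. c m > 0"
    and d: "real d = real CARD('n) + 1"
  defines "z \<equiv> x $ Radial" and "Y \<equiv> \<lambda>m. a m * (c m * x $ Radial) powr (2 * m)"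
  shows "reduced_stress d S a (brane_metric F) (linear_scalar c) i j x = (if i \<noteq> j then 0 else
    brane_coeff F i z * ((\<Sum>m\<in>S. Y m) - (case i of Space k \<Rightarrow> 0 | _ \<Rightarrow> (\<Sum>m\<in>S. m * Y m))))"
proof -
  let ?n = "real CARD('n)" and ?P = "\<Sum>m\<in>S. Y m" and ?Q = "\<Sum>m\<in>S. m * Y m"
  have st: "stress S a (brane_metric F) (linear_scalar c) i j x = (if i \<noteq> j then 0 else
      brane_coeff F i z * ((case i of Space k \<Rightarrow> ?Q | _ \<Rightarrow> 0) - ?n / 2 * ?P))" for i j
    unfolding Y_def z_def by (rule stress_brane[of x F, OF x assms(3)])
  have nz: "brane_coeff F i z \<noteq> 0" for i :: "'n coord"
    using x by (cases i) (auto simp: z_def)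
  have "(\<Sum>r\<in>UNIV. \<Sum>s\<in>UNIV. inv_metric (brane_metric F) r s x
       * stress S a (brane_metric F) (linear_scalar c) r s x)
    = (\<Sum>r\<in>(UNIV :: 'n coord set). (case r of Space k \<Rightarrow> ?Q | _ \<Rightarrow> 0) - ?n / 2 * ?P)"
    using nz by (simp add: inv_metric_brane[of x F, OF x] st if_distrib[of "\<lambda>u. u * _"] flip: z_def cong: if_cong)
  also have "\<dots> = ?n * (?Q - (?n + 2) / 2 * ?P)"
    by (simp add: sum_coord algebra_simps)
  finally have tr: "1 / (real d - 1) * (\<Sum>r\<in>UNIV. \<Sum>s\<in>UNIV. inv_metric (brane_metric F) r s x
       * stress S a (brane_metric F) (linear_scalar c) r s x) = ?Q - (?n + 2) / 2 * ?P"
    by (simp add: d)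
  define q where "q = brane_coeff F i z"
  show ?thesis
    unfolding reduced_stress_def tr
    unfolding st brane_metric_nth z_def[symmetric] q_def[symmetric]
    by (auto simp: field_simps split: coord.split)
qed

section \<open>The electric field and its stress\<close>

lemma gauge_component_has_derivative:
  "((\<lambda>z. \<mu> * (1 - z ^ (d - 2))) has_real_derivative - \<mu> * real (d - 2) * z ^ (d - 3)) (at z)"
proof -
  have e: "d - 2 - Suc 0 = d - 3" by simp
  have "((\<lambda>z. 1 - z ^ (d - 2)) has_real_derivative 0 - real (d - 2) * z ^ (d - 2 - Suc 0)) (at z)"
    by (intro DERIV_diff DERIV_const DERIV_pow)
  from DERIV_cmult[OF this[unfolded e], of \<mu>] show ?thesis by (simp add: mult.assoc)
qed

lemma field_strength_gauge_potential:
  fixes x :: "real^('n::finite coord)"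
  shows "field_strength (gauge_potential d \<mu>) i j x =
    (if i = Radial \<and> j = Time then - \<mu> * real (d - 2) * (x $ Radial) ^ (d - 3)
     else if i = Time \<and> j = Radial then \<mu> * real (d - 2) * (x $ Radial) ^ (d - 3) else 0)"
proof -
  note * = gauge_component_has_derivative
  have "partial k (\<lambda>y. gauge_potential d \<mu> y $ l) x =
     (if k = Radial \<and> l = Time then - \<mu> * real (d - 2) * (x $ Radial) ^ (d - 3) else 0)"
    for k l :: "'n coord"
    using partial_radial[OF *, of k] by (cases "l = Time") (auto simp: gauge_potential_def)
  then show ?thesis by (auto simp: field_strength_def)
qed

text \<open>The product of the inverse coefficients of \<open>Time\<close> and \<open>Radial\<close>
  is -z^4, independent of F; hence the exponent (d - 3) + 4.\<close>

lemma field_strength_up_brane: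
  fixes x :: "real^('n::finite coord)"
  assumes "d \<ge> 3" and x: "x $ Radial > 0" "F (x $ Radial) > 0"
  shows "field_strength_up (brane_metric F) (gauge_potential d \<mu>) i j x =
    (if i = Radial \<and> j = Time then \<mu> * real (d - 2) * (x $ Radial) ^ (d + 1)
     else if i = Time \<and> j = Radial then - \<mu> * real (d - 2) * (x $ Radial) ^ (d + 1) else 0)"
proof -
  \<comment> \<open>Removes the truncated subtractions from the exponents.\<close>
  obtain e where e: "d = e + 3" using assms(1) by (metis le_add_diff_inverse2)
  have "field_strength_up (brane_metric F) (gauge_potential d \<mu>) i j x =
     1 / brane_coeff F i (x $ Radial) * (1 / brane_coeff F j (x $ Radial))
       * field_strength (gauge_potential d \<mu>) i j x"
  proof -
    have "inv_metric (brane_metric F) i r x * inv_metric (brane_metric F) j s x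
        * field_strength (gauge_potential d \<mu>) r s x =
      (if j = s then if i = r then 1 / brane_coeff F i (x $ Radial) * (1 / brane_coeff F j (x $ Radial))
         * field_strength (gauge_potential d \<mu>) r s x else 0 else 0)" for r s
      by (simp add: inv_metric_brane[of x F, OF x])
    then show ?thesis by (simp add: field_strength_up_def)
  qed
  then show ?thesis
    using x by (auto simp: field_strength_gauge_potential e power_add field_simps power2_eq_square
        power4_eq_xxxx)
qed

lemma field_strength_sq_brane:
  fixes x :: "real^('n::finite coord)"
  assumes "d \<ge> 3" and x: "x $ Radial > 0" "F (x $ Radial) > 0"
  shows "field_strength_sq (brane_metric F) (gauge_potential d \<mu>) x =
    - 2 * ((real d - 2)\<^sup>2 * \<mu>\<^sup>2 * (x $ Radial) ^ (2 * (d - 1)))"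
proof -
  have "2 * (d - 1) = (d - 3) + (d + 1)" using assms(1) by simp
  then have p: "(x $ Radial) ^ (2 * (d - 1)) = (x $ Radial) ^ (d - 3) * (x $ Radial) ^ (d + 1)"
    by (metis power_add)
  have "real (d - 2) = real d - 2" using assms(1) by simp
  then show ?thesis
    unfolding p by (simp add: field_strength_sq_def sum_coord field_strength_gauge_potential
        field_strength_up_brane[of d x F, OF assms] power2_eq_square mult_ac)
qed

text \<open>Only the t-z component is nonzero, so each of these two diagonal entries uses the
  inverse coefficient of the other direction: g^{zz} = -z^4 g_{tt} and g^{tt} = -z^4 g_{zz}.\<close>

lemma maxwell_stress_brane:
  fixes x :: "real^('n::finite coord)"
  assumes "d \<ge> 3" and x: "x $ Radial > 0" "F (x $ Radial) > 0"
  shows "(\<Sum>r\<in>UNIV. \<Sum>s\<in>UNIV. inv_metric (brane_metric F) r s x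
      * field_strength (gauge_potential d \<mu>) i r x * field_strength (gauge_potential d \<mu>) j s x) =
    (if i \<noteq> j then 0 else - brane_coeff F i (x $ Radial) *
      (case i of Space k \<Rightarrow> 0 | _ \<Rightarrow> (real d - 2)\<^sup>2 * \<mu>\<^sup>2 * (x $ Radial) ^ (2 * (d - 1))))"
proof -
  let ?f = "field_strength (gauge_potential d \<mu>)"
  have "2 * (d - 1) = (d - 3) + (d - 3) + 2 + 2" using assms(1) by simp
  then have p: "(x $ Radial) ^ (2 * (d - 1))
      = (x $ Radial) ^ (d - 3) * (x $ Radial) ^ (d - 3) * (x $ Radial)\<^sup>2 * (x $ Radial)\<^sup>2"
    by (metis power_add)
  have d2: "real (d - 2) = real d - 2" using assms(1) by simp
  have "inv_metric (brane_metric F) r s x * ?f i r x * ?f j s x =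
      (if r = s then 1 / brane_coeff F r (x $ Radial) * ?f i r x * ?f j r x else 0)" for r s
    by (simp add: inv_metric_brane[of x F, OF x])
  then have "(\<Sum>r\<in>UNIV. \<Sum>s\<in>UNIV. inv_metric (brane_metric F) r s x * ?f i r x * ?f j s x) =
      (\<Sum>r\<in>UNIV. 1 / brane_coeff F r (x $ Radial) * ?f i r x * ?f j r x)"
    by simp
  also have "\<dots> = (if i \<noteq> j then 0 else - brane_coeff F i (x $ Radial) *
      (case i of Space k \<Rightarrow> 0 | _ \<Rightarrow> (real d - 2)\<^sup>2 * \<mu>\<^sup>2 * (x $ Radial) ^ (2 * (d - 1))))"
    unfolding p using x by (cases i; cases j)
      (simp_all add: sum_coord field_strength_gauge_potential d2 power2_eq_square)
  finally show ?thesis .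
qed

subsection \<open>Field equations\<close>

lemma einstein_brane:
  fixes x :: "real^('n::finite coord)"
  assumes "d \<ge> 3" "CARD('n) = d - 1" "finite S" and c: "\<forall>m\<in>S. c m > 0"
    and x: "x $ Radial > 0" "blackening d S a c m0 \<mu> (x $ Radial) > 0"
  shows "einstein_equation d S a (brane_metric (blackening d S a c m0 \<mu>)) (gauge_potential d \<mu>)
    (linear_scalar c) x"
proof -
  let ?F = "blackening d S a c m0 \<mu>" and ?z = "x $ Radial" and ?G = "blackening_source d S a c \<mu>"
  define F' where "F' z = (?G z + real d * ?F z) / z" for z
  define E where "E = (real d - 2)\<^sup>2 * \<mu>\<^sup>2 * ?z ^ (2 * (d - 1))"
  define Y where "Y = (\<lambda>m. a m * (c m * ?z) powr (2 * m))"
  define P where "P = (\<Sum>m\<in>S. Y m)"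
  define Q where "Q = (\<Sum>m\<in>S. m * Y m)"
  have n: "real CARD('n) = real d - 1" using assms by (simp add: of_nat_diff)
  have F': "(?F has_real_derivative F' z) (at z)" if "z > 0" for z
    unfolding F'_def using blackening_deriv[OF assms(1,3) c that] .
  have "2 * Q = (\<Sum>m\<in>S. 2 * m * (a m * (c m * ?z) powr (2 * m)))"
    by (simp add: Q_def Y_def sum_distrib_left mult_ac)
  then have G': "(?G has_real_derivative (E + 2 * Q) / ?z) (at ?z)"
    using blackening_source_deriv[OF assms(1) c x(1)] by (simp add: E_def)
  have G: "?G ?z = - real d + E / (2 * (real d - 1)) + P"
    by (simp add: blackening_source_def E_def P_def Y_def)
  have zF': "?z * F' ?z = ?G ?z + real d * ?F ?z" using x by (simp add: F'_def)
  \<comment> \<open>Differentiating z F' = G + d F gives z F'' = G' + (d - 1) F', so the explicit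
    sums need not be differentiated twice.\<close>
  have F'': "(F' has_real_derivative ((E + 2 * Q) / ?z + (real d - 1) * F' ?z) / ?z) (at ?z)"
    unfolding F'_def[abs_def]
    by (rule DERIV_cong[OF DERIV_divide[OF DERIV_add[OF G' DERIV_cmult[OF F'[OF x(1)]]] DERIV_ident]])
      (use x in \<open>auto simp: F'_def field_simps\<close>)
  \<comment> \<open>\<open>ricci_brane\<close> needs an open set of radii with F > 0; continuity of
    F makes the full positivity set open.\<close>
  define V where "V = {z. z > 0 \<and> ?F z > 0}"
  have "continuous_on {0<..} ?F"
    by (rule continuous_at_imp_continuous_on) (use F' in \<open>auto intro: DERIV_isCont\<close>)
  then have "open ({0<..} \<inter> ?F -` {0<..})"
    by (intro continuous_open_preimage) auto
  then have "open V" by (simp add: V_def Int_def vimage_def greaterThan_def)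
  note ric = ricci_brane[OF this _ _ _ F'', unfolded n]
  have ric: "ricci (brane_metric ?F) i j x = (if i \<noteq> j then 0 else brane_coeff ?F i ?z *
     (case i of Space k \<Rightarrow> ?G ?z | _ \<Rightarrow> ?G ?z - E / 2 - Q))" for i j :: "'n coord"
  proof -
    have z2: "- ?z\<^sup>2 * (((E + 2 * Q) / ?z + (real d - 1) * F' ?z) / ?z) / 2
        = - (E + 2 * Q) / 2 - (real d - 1) * (?z * F' ?z) / 2"
      using x by (simp add: field_simps power2_eq_square)
    have sp: "?z * F' ?z - (real d - 1 + 1) * ?F ?z = ?G ?z"
      unfolding zF' by simp
    \<comment> \<open>The multiples (d + 1)/2 and -(d - 1)/2 of z F' combine to a single z F', so G
      reappears.\<close>
    have ra: "- ?z\<^sup>2 * (((E + 2 * Q) / ?z + (real d - 1) * F' ?z) / ?z) / 2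
        + (real d - 1 + 2) / 2 * ?z * F' ?z - (real d - 1 + 1) * ?F ?z = ?G ?z - E / 2 - Q"
      unfolding z2 mult.assoc zF' by (simp add: field_simps)
    have "ricci (brane_metric ?F) i j x = (if i \<noteq> j then 0 else brane_coeff ?F i ?z *
       (case i of Space k \<Rightarrow> ?z * F' ?z - (real d - 1 + 1) * ?F ?z
        | _ \<Rightarrow> - ?z\<^sup>2 * (((E + 2 * Q) / ?z + (real d - 1) * F' ?z) / ?z) / 2
          + (real d - 1 + 2) / 2 * ?z * F' ?z - (real d - 1 + 1) * ?F ?z))"
      by (rule ric) (use x F' in \<open>auto simp: V_def\<close>)
    then show ?thesis unfolding sp ra .
  qed
  show ?thesis
    unfolding einstein_equation_def
  proof (intro allI)
    fix i j :: "'n coord"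
    have d: "real d = real CARD('n) + 1" using n by simp
    have d1: "real d - 1 > 0" using assms by simp
    note mx = maxwell_stress_brane[of d x ?F \<mu>, OF assms(1) x, folded E_def]
    have rs: "reduced_stress d S a (brane_metric ?F) (linear_scalar c) i j x = (if i \<noteq> j then 0 else
        brane_coeff ?F i ?z * (P - (case i of Space k \<Rightarrow> 0 | _ \<Rightarrow> Q)))" for i j :: "'n coord"
      unfolding P_def Q_def Y_def by (rule reduced_stress_brane[of x ?F, OF x c d])
    note sq = field_strength_sq_brane[of d x ?F \<mu>, OF assms(1) x, folded E_def]
    show "ricci (brane_metric ?F) i j x =
        - real d * brane_metric ?F x $ i $ j
        + 1/2 * ((\<Sum>r\<in>UNIV. \<Sum>s\<in>UNIV. inv_metric (brane_metric ?F) r s x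
                    * field_strength (gauge_potential d \<mu>) i r x
                    * field_strength (gauge_potential d \<mu>) j s x)
                 - 1 / (2 * (real d - 1)) * field_strength_sq (brane_metric ?F) (gauge_potential d \<mu>) x
                   * brane_metric ?F x $ i $ j)
        + reduced_stress d S a (brane_metric ?F) (linear_scalar c) i j x"
    proof (cases "i = j")
      case False
      then show ?thesis by (simp add: ric mx rs brane_metric_nth)
    next
      case True
      define q where "q = brane_coeff ?F j ?z"
      \<comment> \<open>All terms are multiples of \<open>q\<close>. The spatial case is the formula
        \<open>G\<close>; for \<open>Time\<close> and \<open>Radial\<close> both sides are lowered
        by E/2 + Q.\<close>
      show ?thesis
        unfolding True ric mx rs sq brane_metric_nth G
        unfolding q_def[symmetric]
        using d1 by (cases j; simp add: field_simps)
    qed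
  qed
qed

section \<open>Maxwell and scalar equations\<close>

lemma christoffel_brane:
  fixes x :: "real^('n::finite coord)"
  assumes x: "x $ Radial > 0" "F (x $ Radial) > 0"
    and F': "(F has_real_derivative F' (x $ Radial)) (at (x $ Radial))"
  defines "z \<equiv> x $ Radial"
  defines "D \<equiv> \<lambda>i. brane_coeff_deriv F F' i z"
  shows "christoffel (brane_metric F) r i j x =
    (if i = Radial \<and> r = j then D r / (2 * brane_coeff F r z) else 0)
    + (if j = Radial \<and> r = i then D r / (2 * brane_coeff F r z) else 0)
    - (if r = Radial \<and> i = j then D i / (2 * brane_coeff F (Radial :: 'n coord) z) else 0)"
proof -
  have nz: "brane_coeff F i (x $ Radial) \<noteq> 0" for i :: "'n coord"
    using x by (cases i) auto
  show ?thesis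
    unfolding brane_metric_eq_diag D_def z_def
    by (rule christoffel_diag[where w = "brane_coeff F" and \<rho> = Radial and x = x
          and D = "\<lambda>i. brane_coeff_deriv F F' i (x $ Radial)", OF nz brane_coeff_has_derivative[of _ F F', OF x F']])
qed

text \<open>The volume density is z^-(d+1) and the raised field strength is proportional to z^(d+1),
  so their product is constant and the divergence vanishes.\<close>

lemma maxwell_brane:
  fixes x :: "real^('n::finite coord)"
  assumes "d \<ge> 3" "CARD('n) = d - 1" and U: "open U" "x \<in> U"
    and pos: "\<And>y. y \<in> U \<Longrightarrow> y $ Radial > 0 \<and> F (y $ Radial) > 0"
    and F': "(F has_real_derivative F' (x $ Radial)) (at (x $ Radial))"
  shows "maxwell_equation (brane_metric F) (gauge_potential d \<mu>) x"
  unfolding maxwell_equation_def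
proof
  fix j :: "'n coord"
  let ?z = "x $ Radial" and ?q = "\<mu> * real (d - 2)"
  let ?B = "field_strength_up (brane_metric F) (gauge_potential d \<mu>)"
  let ?\<Gamma> = "\<lambda>r i j. christoffel (brane_metric F) r i j x"
  have x: "?z > 0" "F ?z > 0" using pos U by auto
  have B: "?B i j y = (if i = Radial \<and> j = Time then ?q * (y $ Radial) ^ (d + 1)
     else if i = Time \<and> j = Radial then - ?q * (y $ Radial) ^ (d + 1) else 0)"
    if "y \<in> U" for i j y
    using field_strength_up_brane[OF assms(1), of y F \<mu> i j] pos[OF that] by simp
  note chr = christoffel_brane[where F=F and F'=F', OF x F']
  have pB: "partial i (?B i j) x = (if i = Radial \<and> j = Time then ?q * real (d + 1) * ?z ^ d else 0)" for i
  proof -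
    have pw: "((\<lambda>z. z ^ (d + 1)) has_real_derivative real (d + 1) * ?z ^ d) (at ?z)"
      using DERIV_pow[of "d + 1" ?z] by simp
    let ?b = "\<lambda>z. if i = Radial \<and> j = Time then ?q * z ^ (d + 1)
      else if i = Time \<and> j = Radial then - ?q * z ^ (d + 1) else 0"
    have "(?b has_real_derivative (if i = Radial \<and> j = Time then ?q * (real (d + 1) * ?z ^ d)
      else if i = Time \<and> j = Radial then - ?q * (real (d + 1) * ?z ^ d) else 0)) (at ?z)"
      using DERIV_cmult[OF pw, of ?q] DERIV_cmult[OF pw, of "- ?q"] by auto
    from partial_radial[OF this, of i] show ?thesis
      by (subst partial_cong_open[OF U B]) auto
  qed
  \<comment> \<open>The logarithmic derivative of the volume density; the F-dependent parts cancel
    between \<open>Time\<close> and \<open>Radial\<close>.\<close>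
  have tr: "(\<Sum>i\<in>UNIV. ?\<Gamma> i i l) = (if l = Radial then - (real d + 1) / ?z else 0)" for l
  proof -
    have "?\<Gamma> i i l = (if l = Radial then
        brane_coeff_deriv F F' i ?z / (2 * brane_coeff F i ?z) else 0)" for i
      by (auto simp: chr)
    then show ?thesis
      using x assms(1,2) by (simp add: sum_coord brane_coeff_deriv_def field_simps
          power2_eq_square power3_eq_cube of_nat_diff)
  qed
  have 1: "(\<Sum>i\<in>UNIV. \<Sum>l\<in>UNIV. ?\<Gamma> i i l * ?B l j x) = - (real d + 1) / ?z * ?B Radial j x"
    by (subst sum.swap) (simp add: tr if_distrib[of "\<lambda>u. u * _"] flip: sum_distrib_right cong: if_cong)
  \<comment> \<open>A symmetric symbol is contracted with an antisymmetric tensor.\<close>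
  have 2: "(\<Sum>i\<in>UNIV. \<Sum>l\<in>UNIV. ?\<Gamma> j i l * ?B i l x) = 0"
    by (auto simp: sum_coord B[OF U(2)] chr)
  have "(\<Sum>i\<in>UNIV. cov_deriv_bivector (brane_metric F) ?B i i j x) =
      (\<Sum>i\<in>UNIV. partial i (?B i j) x) + - (real d + 1) / ?z * ?B Radial j x"
    by (simp add: cov_deriv_bivector_def sum.distrib 1 2)
  also have "\<dots> = 0"
    unfolding pB using x by (cases "j = Time") (simp_all add: sum_coord B[OF U(2)] field_simps)
  finally show "(\<Sum>i\<in>UNIV. cov_deriv_bivector (brane_metric F) ?B i i j x) = 0" .
qed

text \<open>The current has only its \<open>Space I\<close> component, which depends on z alone, so
  it has no derivative along its own direction. The Christoffel terms vanish as well, since no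
  symbol with two equal lower indices has a spatial upper index.\<close>

lemma scalar_brane:
  fixes x :: "real^('n::finite coord)"
  assumes U: "open U" "x \<in> U" and "c m > 0"
    and pos: "\<And>y. y \<in> U \<Longrightarrow> y $ Radial > 0 \<and> F (y $ Radial) > 0"
    and F': "(F has_real_derivative F' (x $ Radial)) (at (x $ Radial))"
  shows "scalar_equation m (brane_metric F) (linear_scalar c m I) x"
proof -
  let ?z = "x $ Radial" and ?g = "brane_metric F"
  have x: "?z > 0" "F ?z > 0" using pos U by auto
  note chr = christoffel_brane[where F=F and F'=F', OF x F']
  define w where "w k y = kinetic ?g (linear_scalar c m I) y powr (m - 1) * partial k (linear_scalar c m I) y"
    for k y
  have w: "w k y = (if k = Space I then ((c m * y $ Radial)\<^sup>2) powr (m - 1) * c m else 0)"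
    if "y \<in> U" for k y
    using pos[OF that] by (simp add: w_def kinetic_brane partial_linear_scalar)
  have pw: "partial i (w i) x = 0" for i
  proof -
    let ?f = "\<lambda>z. if i = Space I then ((c m * z)\<^sup>2) powr (m - 1) * c m else 0"
    \<comment> \<open>Existence suffices: the value would matter only if \<open>Space I\<close> were
      \<open>Radial\<close>.\<close>
    have "\<exists>D. ((\<lambda>z. ((c m * z)\<^sup>2) powr (m - 1) * c m) has_real_derivative D) (at ?z)"
      using x assms(3) by (intro exI) (auto intro!: derivative_eq_intros)
    then obtain D where "(?f has_real_derivative (if i = Space I then D else 0)) (at ?z)"
      by (cases "i = Space I") auto
    from partial_radial[OF this, of i] show ?thesis
      by (subst partial_cong_open[OF U w]) auto
  qed
  have "cov_deriv_covector ?g w i i x = 0" for i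
    by (auto simp: cov_deriv_covector_def pw w[OF U(2)] chr intro!: sum.neutral)
  then have "(\<Sum>i\<in>UNIV. \<Sum>j\<in>UNIV. inv_metric ?g i j x * cov_deriv_covector ?g w i j x) = 0"
    by (auto simp: inv_metric_brane[of x F, OF x] intro!: sum.neutral)
  then show ?thesis by (simp add: scalar_equation_def w_def[abs_def])
qed

theorem mainTheorem1:
  fixes d :: nat
    and S :: "real set"
    and a c :: "real \<Rightarrow> real"
    and m0 \<mu> :: real
    and U :: "(real^('n::finite coord)) set"
  assumes "d \<ge> 3"
    and "CARD('n) = d - 1"
    and "finite S"
    and "\<forall>m\<in>S. m > 0"
    and "\<forall>m\<in>S. c m > 0"
    and "open U"
    and "\<forall>x\<in>U. x $ Radial > 0 \<and> blackening d S a c m0 \<mu> (x $ Radial) > 0"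
  shows "ems_solution_on U d S a
           (brane_metric (blackening d S a c m0 \<mu>))
           (gauge_potential d \<mu>)
           (linear_scalar c)"
proof -
  let ?F = "blackening d S a c m0 \<mu>"
  define F' where "F' z = (blackening_source d S a c \<mu> z + real d * ?F z) / z" for z
  have F': "(?F has_real_derivative F' z) (at z)" if "z > 0" for z
    unfolding F'_def using blackening_deriv[OF assms(1,3,5) that] .
  have dF: "?F differentiable (at z)" if "z > 0" for z
    using F'[OF that] by (auto simp: real_differentiable_def)
  \<comment> \<open>The first-order equation expresses F' through F and the source, both
    differentiable, which yields the second derivative of F.\<close>
  have dF': "F' differentiable (at z)" if "z > 0" for z
  proof -
    have "blackening_source d S a c \<mu> differentiable (at z)"
      using blackening_source_deriv[OF assms(1,5) that, of a \<mu>]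
      unfolding real_differentiable_def by blast
    then show ?thesis
      unfolding F'_def[abs_def] using dF[OF that] that by (intro derivative_intros) auto
  qed
  have pos: "x $ Radial > 0 \<and> ?F (x $ Radial) > 0" if "x \<in> U" for x
    using assms(7) that by blast
  have "twice_differentiable_on (\<lambda>x. brane_metric ?F x $ i $ j) U" for i j :: "'n coord"
  proof (cases "i = j")
    case True
    have "brane_coeff_deriv ?F F' j differentiable (at z)" if "z > 0" "?F z > 0" for z
      using that dF[OF that(1)] dF'[OF that(1)]
      by (cases j) (auto simp: brane_coeff_deriv_def[abs_def] intro!: derivative_intros)
    then have "twice_differentiable_on (\<lambda>x. brane_coeff ?F j (x $ Radial)) U"
      using pos F' by (intro twice_differentiable_on_radial[where f' = "brane_coeff_deriv ?F F' j", OF assms(6)]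
          brane_coeff_has_derivative) auto
    then show ?thesis using True by (simp add: brane_metric_nth)
  next
    case False
    then show ?thesis by (simp add: brane_metric_nth twice_differentiable_on_const)
  qed
  moreover have "twice_differentiable_on (\<lambda>x. gauge_potential d \<mu> x $ i) U" for i :: "'n coord"
  proof (cases "i = Time")
    case True
    have "twice_differentiable_on (\<lambda>x. \<mu> * (1 - (x $ Radial) ^ (d - 2))) U"
      by (rule twice_differentiable_on_radial[OF assms(6) gauge_component_has_derivative])
        (intro derivative_intros)
    then show ?thesis using True by (simp add: gauge_potential_def)
  next
    case False
    then show ?thesis by (simp add: gauge_potential_def twice_differentiable_on_const)
  qed
  moreover have "twice_differentiable_on (linear_scalar c m I) U" for m and I :: 'n
    unfolding linear_scalar_def[abs_def]
    by (rule twice_differentiable_on_radial[OF assms(6) DERIV_cmult_Id]) simp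
  moreover have "lorentzian (brane_metric ?F x)" if "x \<in> U" for x
    unfolding brane_metric_eq_diag
  proof (rule lorentzian_diag)
    fix i :: "'n coord" assume "i \<noteq> Time"
    then show "brane_coeff ?F i (x $ Radial) > 0" using pos[OF that] by (cases i) auto
  qed (use pos[OF that] in simp)
  moreover have "kinetic (brane_metric ?F) (linear_scalar c m I) x > 0"
    if "x \<in> U" "m \<in> S" for x m and I :: 'n
    using pos[OF that(1)] assms(5) that(2) by (simp add: kinetic_brane less_imp_neq[THEN not_sym])
  moreover have "einstein_equation d S a (brane_metric ?F) (gauge_potential d \<mu>) (linear_scalar c) x"
    if "x \<in> U" for x
    using einstein_brane[OF assms(1,2,3,5)] pos[OF that] by blast
  moreover have "maxwell_equation (brane_metric ?F) (gauge_potential d \<mu>) x" if "x \<in> U" for x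
    by (rule maxwell_brane[where F = ?F and F' = F', OF assms(1,2,6) that pos F']) (use pos[OF that] in auto)
  moreover have "scalar_equation m (brane_metric ?F) (linear_scalar c m I) x"
    if "x \<in> U" "m \<in> S" for x m and I :: 'n
    by (rule scalar_brane[where F = ?F and F' = F', OF assms(6) that(1) _ pos F']) (use pos[OF that(1)] assms(5) that(2) in auto)
  ultimately show ?thesis
    unfolding ems_solution_on_def by blast
qed

end
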